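(* Let $X$ be a finite rack with $|X| = m$ and let $B_1$ and $B_2$ be two $n$-braids. Then the rack counting matrix of the concatenated braid $B_1B_2$ satisfies $$\Phi_X^{M_{m^n}}(B_1B_2) = \Phi_X^{M_{m^n}}(B_1)\cdot \Phi_X^{M_{m^n}}(B_2).$$ As a result, the mapping $B \mapsto \Phi_X^{M_{m^n}}(B)$ defines a linear representation of the braid group $B_n$.
   Context: A rack is a set $X$ with a binary operation $\triangleright: X\times X\to X$ such that (1) for all $y\in X$ the map $\beta_y(x)=x\triangleright y$ is a bijection of $X$, with $\beta_y^{-1}(x)$ denoted $x\triangleright^{-1}y$; and (2) $(x\triangleright y)\triangleright z=(x\triangleright z)\triangleright(y\triangleright z)$ for all $x,y,z\in X$. The $n$-braid group $B_n$ is generated by $\sigma_1,\dots,\sigma_{n-1}$ with relations $\sigma_i\sigma_j=\sigma_j\sigma_i$ for $|i-j|\ge 2$ and $\sigma_i\sigma_{i+1}\sigma_i=\sigma_{i+1}\sigma_i\sigma_{i+1}$ for $1\le i\le n-2$. An $n$-braid is an element of $B_n$; it is represented by braid words (diagrams) in the $\sigma_i^{\pm1}$, read from left to right as crossings from top to bottom. The product (concatenation) $\alpha\beta$ is $\alpha$ placed above $\beta$. Coloring rule: colors in $X$ of the $n$ top endpoints propagate down through the braid. At a crossing $\sigma_i$, if the colors in positions $(i,i+1)$ above the crossing are $(x,y)$, then below they are $(y,\,x\triangleright y)$; at a crossing $\sigma_i^{-1}$, if the colors in positions $(i,i+1)$ above are $(y,x)$, then below they are $(x\triangleright^{-1}y,\,y)$;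 the colors in all other positions are unchanged. Thus a top coloring in $X^n$ extends to a unique bottom coloring in $X^n$, and the bottom coloring depends only on the braid and not on the representing word. For a finite rack $X$ with $|X|=m$ and an $n$-braid $B$, the rack counting matrix $\Phi_X^{M_{m^n}}(B)$ is the $m^n\times m^n$ matrix with rows and columns indexed by $X^n$, whose $(i,j)$-entry ($i,j\in X^n$) is $1$ if the top coloring $i$ extends through $B$ to the bottom coloring $j$, and $0$ otherwise. *)

theory Defs
  imports "Jordan_Normal_Form.Matrix" "HOL-Algebra.Group"
begin

locale rack =
  fixes X :: "'x set" and rk :: "'x \<Rightarrow> 'x \<Rightarrow> 'x"  (infixl "\<triangleright>" 70)
  assumes closed: "\<lbrakk>x \<in> X; y \<in> X\<rbrakk> \<Longrightarrow> x \<triangleright> y \<in> X"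
    and bij: "y \<in> X \<Longrightarrow> bij_betw (\<lambda>x. x \<triangleright> y) X X"
    and self_distrib: "\<lbrakk>x \<in> X; y \<in> X; z \<in> X\<rbrakk> \<Longrightarrow> (x \<triangleright> y) \<triangleright> z = (x \<triangleright> z) \<triangleright> (y \<triangleright> z)"

definition rack_inv :: "'x set \<Rightarrow> ('x \<Rightarrow> 'x \<Rightarrow> 'x) \<Rightarrow> 'x \<Rightarrow> 'x \<Rightarrow> 'x"
  where "rack_inv X rk x y = inv_into X (\<lambda>z. rk z y) x"

datatype braid_letter = Sig nat | SigInv nat

type_synonym braid_word = "braid_letter list"

definition braid_words :: "nat \<Rightarrow> braid_word set"
  where "braid_words n = lists (Sig ` {1..<n} \<union> SigInv ` {1..<n})"

text \<open>The group presentation as a congruence on words in the generators and their formal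
  inverses: the least congruence containing free cancellation and the braid relations.\<close>

inductive_set braid_rel :: "nat \<Rightarrow> (braid_word \<times> braid_word) set" for n :: nat
  where
    refl: "w \<in> braid_words n \<Longrightarrow> (w, w) \<in> braid_rel n"
  | sym: "(u, v) \<in> braid_rel n \<Longrightarrow> (v, u) \<in> braid_rel n"
  | trans: "\<lbrakk>(u, v) \<in> braid_rel n; (v, w) \<in> braid_rel n\<rbrakk> \<Longrightarrow> (u, w) \<in> braid_rel n"
  | append: "\<lbrakk>(u, u') \<in> braid_rel n; (v, v') \<in> braid_rel n\<rbrakk> \<Longrightarrow> (u @ v, u' @ v') \<in> braid_rel n"
  | cancel_right: "i \<in> {1..<n} \<Longrightarrow> ([Sig i, SigInv i], []) \<in> braid_rel n"
  | cancel_left: "i \<in> {1..<n} \<Longrightarrow> ([SigInv i, Sig i], []) \<in> braid_rel n"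
  | far_commute: "\<lbrakk>i \<in> {1..<n}; j \<in> {1..<n}; \<bar>int i - int j\<bar> \<ge> 2\<rbrakk>
      \<Longrightarrow> ([Sig i, Sig j], [Sig j, Sig i]) \<in> braid_rel n"
  | braid: "\<lbrakk>i \<in> {1..<n}; i + 1 \<in> {1..<n}\<rbrakk>
      \<Longrightarrow> ([Sig i, Sig (i + 1), Sig i], [Sig (i + 1), Sig i, Sig (i + 1)]) \<in> braid_rel n"

definition braid_group :: "nat \<Rightarrow> braid_word set monoid"
  where "braid_group n =
    \<lparr> carrier = braid_words n // braid_rel n,
      monoid.mult = (\<lambda>A B. \<Union>u\<in>A. \<Union>v\<in>B. braid_rel n `` {u @ v}),
      one = braid_rel n `` {[]} \<rparr>"

definition colorings :: "'x set \<Rightarrow> nat \<Rightarrow> 'x list set"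
  where "colorings X n = {c. set c \<subseteq> X \<and> length c = n}"

lemma colorings_enumeration_exists:
  assumes "finite X"
  shows "\<exists>e. bij_betw e {..<card X ^ n} (colorings X n)"
  using ex_bij_betw_nat_finite[of "colorings X n"]
    finite_lists_length_eq[OF assms, of n] card_lists_length_eq[OF assms, of n]
  by (simp add: colorings_def atLeast0LessThan)

text \<open>Strand positions are numbered from 1, list entries from 0: position \<open>i\<close> of a
  coloring \<open>c\<close> is \<open>c ! (i - 1)\<close>.\<close>

fun cross :: "'x set \<Rightarrow> ('x \<Rightarrow> 'x \<Rightarrow> 'x) \<Rightarrow> braid_letter \<Rightarrow> 'x list \<Rightarrow> 'x list"
  where
    "cross X rk (Sig i) c =
      (let x = c ! (i - 1); y = c ! i in c[i - 1 := y, i := rk x y])"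
  | "cross X rk (SigInv i) c =
      (let y = c ! (i - 1); x = c ! i in c[i - 1 := rack_inv X rk x y, i := y])"

text \<open>Words are read from left to right as crossings from top to bottom.\<close>

definition propagate :: "'x set \<Rightarrow> ('x \<Rightarrow> 'x \<Rightarrow> 'x) \<Rightarrow> braid_word \<Rightarrow> 'x list \<Rightarrow> 'x list"
  where "propagate X rk w c = fold (cross X rk) w c"

text \<open>For a rack and a braid \<open>B\<close> the result does not depend on the word chosen in \<open>B\<close>.\<close>

definition extends_to ::
    "'x set \<Rightarrow> ('x \<Rightarrow> 'x \<Rightarrow> 'x) \<Rightarrow> braid_word set \<Rightarrow> 'x list \<Rightarrow> 'x list \<Rightarrow> bool"
  where "extends_to X rk B c d \<longleftrightarrow> (\<exists>w\<in>B. propagate X rk w c = d)"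

text \<open>Matrices have rows and columns indexed by natural numbers, so the index set of
  \<open>n\<close>-tuples of colors is enumerated by a bijection \<open>e\<close> from \<open>{..<card X ^ n}\<close>.\<close>

definition rack_counting_matrix ::
    "'x set \<Rightarrow> ('x \<Rightarrow> 'x \<Rightarrow> 'x) \<Rightarrow> nat \<Rightarrow> (nat \<Rightarrow> 'x list) \<Rightarrow> braid_word set \<Rightarrow> 'k :: field mat"
  where "rack_counting_matrix X rk n e B =
    mat (card X ^ n) (card X ^ n) (\<lambda>(i, j). if extends_to X rk B (e i) (e j) then 1 else 0)"

definition GL :: "'k :: field itself \<Rightarrow> nat \<Rightarrow> 'k mat monoid"
  where "GL TYPE('k) d = units_of (ring_mat TYPE('k) d ())"

definition linear_representation ::
    "('g, 'b) monoid_scheme \<Rightarrow> nat \<Rightarrow> ('g \<Rightarrow> 'k :: field mat) \<Rightarrow> bool"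
  where "linear_representation G d \<rho> \<longleftrightarrow> group_hom G (GL TYPE('k) d) \<rho>"

end

(* A braid word acts on the colorings by composing the maps of its crossings; the relations of the
   presentation act trivially, the braid relation being exactly self-distributivity. The rack
   counting matrix of a braid is therefore the matrix of a self-map of the finite set of colorings,
   and such matrices multiply as the maps compose. Braids are invertible, hence so are their
   matrices. *)

theory Submission
  imports Defs
begin

section \<open>The braid group\<close>

lemma Nil_in_braid_words [simp]: "[] \<in> braid_words n"
  by (simp add: braid_words_def)

lemma append_in_braid_words [simp]:
  "u @ v \<in> braid_words n \<longleftrightarrow> u \<in> braid_words n \<and> v \<in> braid_words n"
  by (simp add: braid_words_def)

lemma Cons_in_braid_words:
  "a # w \<in> braid_words n \<longleftrightarrow> a \<in> Sig ` {1..<n} \<union> SigInv ` {1..<n} \<and> w \<in> braid_words n"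
  by (auto simp: braid_words_def)

lemma braid_rel_in_words:
  assumes "(u, v) \<in> braid_rel n"
  shows "u \<in> braid_words n \<and> v \<in> braid_words n"
  using assms by induction (auto simp: Cons_in_braid_words)

lemma equiv_braid_rel: "equiv (braid_words n) (braid_rel n)"
  by (intro equivI subrelI refl_onI symI transI)
    (auto dest: braid_rel_in_words intro: braid_rel.refl braid_rel.sym braid_rel.trans)

lemma carrier_braid_group: "carrier (braid_group n) = braid_words n // braid_rel n"
  by (simp add: braid_group_def)

lemma one_braid_group: "\<one>\<^bsub>braid_group n\<^esub> = braid_rel n `` {[]}"
  by (simp add: braid_group_def)

lemma braid_class_in_carrier:
  "w \<in> braid_words n \<Longrightarrow> braid_rel n `` {w} \<in> carrier (braid_group n)"
  by (simp add: carrier_braid_group quotientI)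

text \<open>The product is defined as a union over all pairs of representatives. Since
  \<open>braid_rel\<close> is closed under appending, every pair contributes the same class, so one
  pair suffices.\<close>

lemma braid_class_mult:
  assumes "u \<in> braid_words n" "v \<in> braid_words n"
  shows "braid_rel n `` {u} \<otimes>\<^bsub>braid_group n\<^esub> braid_rel n `` {v} = braid_rel n `` {u @ v}"
proof -
  have "(\<lambda>u v. braid_rel n `` {u @ v}) respects2 braid_rel n"
    by (intro congruent2I' equiv_class_eq[OF equiv_braid_rel] braid_rel.append)
  from UN_equiv_class2[OF equiv_braid_rel equiv_braid_rel this assms]
  show ?thesis
    by (simp add: braid_group_def)
qed

lemma braid_carrierE:
  assumes "B \<in> carrier (braid_group n)"
  obtains w where "w \<in> braid_words n" "B = braid_rel n `` {w}"
  using assms by (auto simp: carrier_braid_group elim: quotientE)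

text \<open>The inverse reverses the word and inverts each letter. In the induction the inverse
  \<open>b\<close> of the head goes to the end of the word \<open>v\<close> obtained for the tail,
  so that \<open>b\<close> and \<open>a\<close> meet and cancel first.\<close>

lemma braid_word_left_inverse:
  assumes "w \<in> braid_words n"
  shows "\<exists>v\<in>braid_words n. (v @ w, []) \<in> braid_rel n"
  using assms
proof (induction w)
  case Nil
  show ?case
    using braid_rel.refl[OF Nil] by force
next
  case (Cons a w)
  then obtain v where v: "v \<in> braid_words n" "(v @ w, []) \<in> braid_rel n"
    by (auto simp: Cons_in_braid_words)
  obtain b where b: "[b] \<in> braid_words n" "([b, a], []) \<in> braid_rel n"
  proof (cases a)
    case (Sig i)
    then show ?thesis
      using Cons.prems braid_rel.cancel_left[of i n]
      by (intro that[of "SigInv i"]) (auto simp: Cons_in_braid_words)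
  next
    case (SigInv i)
    then show ?thesis
      using Cons.prems braid_rel.cancel_right[of i n]
      by (intro that[of "Sig i"]) (auto simp: Cons_in_braid_words)
  qed
  have w: "w \<in> braid_words n"
    using Cons.prems by (simp add: Cons_in_braid_words)
  have "(v @ [b, a] @ w, v @ [] @ w) \<in> braid_rel n"
    by (intro braid_rel.append braid_rel.refl v b w)
  then have "((v @ [b]) @ a # w, []) \<in> braid_rel n"
    using braid_rel.trans v(2) by fastforce
  then show ?case
    using v b by (intro bexI[of _ "v @ [b]"]) auto
qed

text \<open>On representatives, associativity and the unit law are those of list append; only left
  inverses use the cancellation relations.\<close>

lemma group_braid_group: "group (braid_group n)"
proof (rule groupI)
  fix A assume "A \<in> carrier (braid_group n)"
  then obtain w where w: "w \<in> braid_words n" "A = braid_rel n `` {w}"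
    by (rule braid_carrierE)
  then obtain v where v: "v \<in> braid_words n" "(v @ w, []) \<in> braid_rel n"
    using braid_word_left_inverse by blast
  then have "braid_rel n `` {v} \<otimes>\<^bsub>braid_group n\<^esub> A = \<one>\<^bsub>braid_group n\<^esub>"
    using w by (simp add: braid_class_mult one_braid_group equiv_class_eq[OF equiv_braid_rel])
  then show "\<exists>B\<in>carrier (braid_group n). B \<otimes>\<^bsub>braid_group n\<^esub> A = \<one>\<^bsub>braid_group n\<^esub>"
    using v braid_class_in_carrier by blast
qed (auto elim!: braid_carrierE simp: braid_class_mult braid_class_in_carrier one_braid_group)

section \<open>Propagation of colorings\<close>

lemma propagate_Nil [simp]: "propagate X rk [] c = c"
  by (simp add: propagate_def)

lemma propagate_Cons: "propagate X rk (a # w) c = propagate X rk w (cross X rk a c)"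
  by (simp add: propagate_def)

lemma propagate_append: "propagate X rk (u @ v) c = propagate X rk v (propagate X rk u c)"
  by (simp add: propagate_def)

context rack
begin

lemma rack_inv_closed: "\<lbrakk>x \<in> X; y \<in> X\<rbrakk> \<Longrightarrow> rack_inv X rk x y \<in> X"
  unfolding rack_inv_def
  by (rule inv_into_into) (use bij bij_betw_imp_surj_on in fastforce)

lemma rack_inv_right: "\<lbrakk>x \<in> X; y \<in> X\<rbrakk> \<Longrightarrow> rack_inv X rk (x \<triangleright> y) y = x"
  unfolding rack_inv_def using bij_betw_inv_into_left[OF bij] by blast

lemma rack_inv_left: "\<lbrakk>x \<in> X; y \<in> X\<rbrakk> \<Longrightarrow> rack_inv X rk x y \<triangleright> y = x"
  unfolding rack_inv_def using bij_betw_inv_into_right[OF bij] by blast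

lemma colorings_nth: "\<lbrakk>c \<in> colorings X n; i < n\<rbrakk> \<Longrightarrow> c ! i \<in> X"
  by (auto simp: colorings_def)

lemma colorings_update: "\<lbrakk>c \<in> colorings X n; x \<in> X\<rbrakk> \<Longrightarrow> c[i := x] \<in> colorings X n"
  using set_update_subset_insert by (fastforce simp: colorings_def)

lemma cross_in_colorings:
  assumes "a \<in> Sig ` {1..<n} \<union> SigInv ` {1..<n}" "c \<in> colorings X n"
  shows "cross X rk a c \<in> colorings X n"
  using assms
  by (auto simp: Let_def intro!: colorings_update closed rack_inv_closed colorings_nth)

lemma propagate_in_colorings:
  assumes "w \<in> braid_words n" "c \<in> colorings X n"
  shows "propagate X rk w c \<in> colorings X n"
  using assms
  by (induction w arbitrary: c)
    (simp_all add: Cons_in_braid_words propagate_Cons cross_in_colorings)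

text \<open>Induction over the congruence. The cancellation relations hold because
  \<open>rack_inv\<close> inverts each right action, far commutation because the crossings touch
  disjoint positions, and the braid relation by self-distributivity.\<close>

lemma propagate_braid_rel:
  assumes "(u, v) \<in> braid_rel n" "c \<in> colorings X n"
  shows "propagate X rk u c = propagate X rk v c"
  using assms
proof (induction arbitrary: c)
  case (append u u' v v')
  \<comment> \<open>The hypothesis for \<open>v\<close> and \<open>v'\<close> is applied to the
    coloring already propagated through \<open>u\<close>, which is why \<open>c\<close> is arbitrary
    and colorings must be preserved.\<close>
  then show ?case
    using propagate_in_colorings braid_rel_in_words by (metis propagate_append)
next
  case (cancel_right i)
  \<comment> \<open>Strands count from 1 and list entries from 0, so the crossing acts on the
    entries \<open>k\<close> and \<open>Suc k\<close>. The same shift is made for the other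
    relations.\<close>
  obtain k where k: "i = Suc k"
    using cancel_right.hyps by (cases i) auto
  have [simp]: "length c = n" "c ! k \<in> X" "c ! Suc k \<in> X"
    using cancel_right colorings_nth k by (auto simp: colorings_def)
  show ?case
    by (rule nth_equalityI)
      (use cancel_right k in \<open>auto simp: propagate_Cons Let_def nth_list_update rack_inv_right\<close>)
next
  case (cancel_left i)
  obtain k where k: "i = Suc k"
    using cancel_left.hyps by (cases i) auto
  have [simp]: "length c = n" "c ! k \<in> X" "c ! Suc k \<in> X"
    using cancel_left colorings_nth k by (auto simp: colorings_def)
  show ?case
    by (rule nth_equalityI)
      (use cancel_left k in \<open>auto simp: propagate_Cons Let_def nth_list_update rack_inv_left\<close>)
next
  case (far_commute i j)
  obtain k l where kl: "i = Suc k" "j = Suc l"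
    using far_commute.hyps by (cases i; cases j) auto
  \<comment> \<open>These inequalities say that the pairs \<open>k\<close>, \<open>Suc k\<close> and
    \<open>l\<close>, \<open>Suc l\<close> are disjoint, so neither crossing reads or overwrites an
    entry of the other.\<close>
  then have "k \<noteq> l" "k \<noteq> Suc l" "l \<noteq> Suc k"
    using far_commute.hyps by auto
  then show ?case
    by (simp add: kl propagate_Cons Let_def list_update_swap)
next
  case (braid i)
  obtain k where k: "i = Suc k"
    using braid.hyps by (cases i) auto
  have [simp]: "length c = n" "c ! k \<in> X" "c ! Suc k \<in> X" "c ! Suc (Suc k) \<in> X"
    using braid colorings_nth k by (auto simp: colorings_def)
  \<comment> \<open>From colors x, y, z at \<open>k\<close> and the next two entries, both sides
    yield z and y \<triangleright> z in the first two places. In the third, one gives (x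
    \<triangleright> y) \<triangleright> z and the other (x \<triangleright> z) \<triangleright> (y
    \<triangleright> z).\<close>
  show ?case
    by (rule nth_equalityI)
      (use braid k in \<open>auto simp: propagate_Cons Let_def nth_list_update self_distrib\<close>)
qed auto

text \<open>All words of a class give the same bottom coloring, so the existential in
  \<open>extends_to\<close> can be tested on any chosen word.\<close>

lemma extends_to_braid_class:
  assumes "w \<in> braid_words n" "c \<in> colorings X n"
  shows "extends_to X rk (braid_rel n `` {w}) c d \<longleftrightarrow> propagate X rk w c = d"
  using assms propagate_braid_rel braid_rel.refl by (fastforce simp: extends_to_def)

end

section \<open>Matrices of self-maps\<close>

text \<open>If \<open>e\<close> enumerates a set that \<open>f\<close> maps to itself, each row has
  exactly one 1. This is the matrix of \<open>f\<close> acting on row vectors, stated without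
  reference to racks or braids.\<close>

definition selfmap_mat :: "nat \<Rightarrow> (nat \<Rightarrow> 'a) \<Rightarrow> ('a \<Rightarrow> 'a) \<Rightarrow> 'k :: field mat"
  where "selfmap_mat N e f = mat N N (\<lambda>(i, j). if f (e i) = e j then 1 else 0)"

lemma selfmap_mat_carrier [simp]: "selfmap_mat N e f \<in> carrier_mat N N"
  by (simp add: selfmap_mat_def)

lemma selfmap_mat_id:
  assumes "inj_on e {..<N}"
  shows "selfmap_mat N e (\<lambda>x. x) = 1\<^sub>m N"
  by (rule eq_matI) (use assms in \<open>auto simp: selfmap_mat_def inj_on_def\<close>)

text \<open>The order of composition is reversed because \<open>f\<close> is read along the rows.\<close>

lemma selfmap_mat_comp:
  fixes e :: "nat \<Rightarrow> 'a"
  assumes e: "bij_betw e {..<N} S" and f: "f \<in> S \<rightarrow> S"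
  shows "(selfmap_mat N e (\<lambda>x. g (f x)) :: 'k :: field mat) = selfmap_mat N e f * selfmap_mat N e g"
proof (rule eq_matI)
  fix i j
  assume "i < dim_row (selfmap_mat N e f * selfmap_mat N e g :: 'k mat)"
    "j < dim_col (selfmap_mat N e f * selfmap_mat N e g :: 'k mat)"
  then have ij: "i < N" "j < N"
    by (simp_all add: selfmap_mat_def)
  then have "f (e i) \<in> S"
    using e f bij_betwE by fastforce
  \<comment> \<open>The index \<open>k\<close> of the intermediate point \<open>f (e i)\<close> is
    the only one that can contribute to the matrix product.\<close>
  then obtain k where k: "k < N" "e k = f (e i)"
    using e unfolding bij_betw_def by (metis imageE lessThan_iff)
  have "(selfmap_mat N e f * selfmap_mat N e g) $$ (i, j)
      = (\<Sum>l<N. (if f (e i) = e l then 1 else 0) * (if g (e l) = e j then 1 else 0))"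
    using ij by (simp add: selfmap_mat_def scalar_prod_def atLeast0LessThan)
  \<comment> \<open>Injectivity of \<open>e\<close> turns \<open>f (e i) = e l\<close> into
    \<open>l = k\<close>, which collapses the sum to one term.\<close>
  also have "\<dots> = (\<Sum>l<N. if l = k then (if g (e l) = e j then 1 else 0) else 0)"
    using e k by (intro sum.cong) (auto simp: bij_betw_def inj_on_def)
  also have "\<dots> = (selfmap_mat N e (\<lambda>x. g (f x)) :: 'k mat) $$ (i, j)"
    using ij k by (simp add: selfmap_mat_def)
  finally show "(selfmap_mat N e (\<lambda>x. g (f x)) :: 'k mat) $$ (i, j)
      = (selfmap_mat N e f * selfmap_mat N e g) $$ (i, j)" ..
qed (simp_all add: selfmap_mat_def)

section \<open>The representation\<close>

context rack
begin

lemma rack_counting_matrix_class: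
  assumes "bij_betw e {..<card X ^ n} (colorings X n)" "w \<in> braid_words n"
  shows "rack_counting_matrix X rk n e (braid_rel n `` {w})
    = selfmap_mat (card X ^ n) e (propagate X rk w)"
  unfolding rack_counting_matrix_def selfmap_mat_def
  using bij_betwE[OF assms(1)] by (intro cong_mat) (auto simp: extends_to_braid_class assms(2))

text \<open>Colors pass through the upper braid first, so propagation through \<open>u @ v\<close>
  applies the map of \<open>u\<close> before that of \<open>v\<close>. This matches the order of
  factors in \<open>selfmap_mat_comp\<close>.\<close>

lemma rack_counting_matrix_mult:
  assumes e: "bij_betw e {..<card X ^ n} (colorings X n)"
    and B: "B1 \<in> carrier (braid_group n)" "B2 \<in> carrier (braid_group n)"
  shows "rack_counting_matrix X rk n e (B1 \<otimes>\<^bsub>braid_group n\<^esub> B2)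
    = rack_counting_matrix X rk n e B1 * rack_counting_matrix X rk n e B2"
proof -
  obtain u v where u: "u \<in> braid_words n" "B1 = braid_rel n `` {u}"
    and v: "v \<in> braid_words n" "B2 = braid_rel n `` {v}"
    using B by (metis braid_carrierE)
  have "propagate X rk u \<in> colorings X n \<rightarrow> colorings X n"
    using u by (simp add: propagate_in_colorings)
  from selfmap_mat_comp[OF e this, of "propagate X rk v"] show ?thesis
    using u v
    by (simp add: braid_class_mult rack_counting_matrix_class[OF e] propagate_append[abs_def])
qed

lemma rack_counting_matrix_one:
  assumes e: "bij_betw e {..<card X ^ n} (colorings X n)"
  shows "rack_counting_matrix X rk n e \<one>\<^bsub>braid_group n\<^esub> = 1\<^sub>m (card X ^ n)"
proof -
  have "propagate X rk [] = (\<lambda>c. c)"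
    by (simp add: fun_eq_iff)
  then show ?thesis
    using selfmap_mat_id[OF bij_betw_imp_inj_on[OF e]]
    by (simp add: one_braid_group rack_counting_matrix_class[OF e])
qed

text \<open>The matrix of the inverse braid is a two-sided inverse, by multiplicativity and the
  value at the unit.\<close>

lemma rack_counting_matrix_in_GL:
  assumes e: "bij_betw e {..<card X ^ n} (colorings X n)"
    and B: "B \<in> carrier (braid_group n)"
  shows "rack_counting_matrix X rk n e B \<in> carrier (GL TYPE('k :: field) (card X ^ n))"
proof -
  interpret group "braid_group n"
    by (rule group_braid_group)
  let ?M = "rack_counting_matrix X rk n e :: braid_word set \<Rightarrow> 'k mat"
  have carrier: "?M C \<in> carrier_mat (card X ^ n) (card X ^ n)" for C
    by (simp add: rack_counting_matrix_def)
  have "?M (inv\<^bsub>braid_group n\<^esub> B) * ?M B = 1\<^sub>m (card X ^ n)"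
    "?M B * ?M (inv\<^bsub>braid_group n\<^esub> B) = 1\<^sub>m (card X ^ n)"
    using B rack_counting_matrix_mult[OF e] rack_counting_matrix_one[OF e]
    by (metis inv_closed l_inv, metis inv_closed r_inv)
  then show ?thesis
    using carrier by (auto simp: GL_def units_of_def Units_def ring_mat_def)
qed

end

theorem theorem5p7:
  fixes X :: "'x set" and rk :: "'x \<Rightarrow> 'x \<Rightarrow> 'x" and m n :: nat
    and e :: "nat \<Rightarrow> 'x list"
  assumes "rack X rk" and "finite X" and "card X = m"
    and "bij_betw e {..<m ^ n} (colorings X n)"
  shows "(\<forall>B1 \<in> carrier (braid_group n). \<forall>B2 \<in> carrier (braid_group n).
            (rack_counting_matrix X rk n e (B1 \<otimes>\<^bsub>braid_group n\<^esub> B2) :: 'k :: field mat)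
              = rack_counting_matrix X rk n e B1 * rack_counting_matrix X rk n e B2)
         \<and> linear_representation (braid_group n) (m ^ n)
             (rack_counting_matrix X rk n e :: braid_word set \<Rightarrow> 'k mat)"
proof -
  interpret rack X rk by fact
  have e: "bij_betw e {..<card X ^ n} (colorings X n)"
    using assms by simp
  have "monoid (ring_mat TYPE('k) (m ^ n) ())"
    by (rule semiring.axioms(2)[OF semiring_mat])
  then have "group (GL TYPE('k) (m ^ n))"
    unfolding GL_def by (rule monoid.units_group)
  \<comment> \<open>Multiplication in \<open>GL\<close> is the matrix product, so the homomorphism
    law is the first claim of the theorem.\<close>
  moreover have "rack_counting_matrix X rk n e \<in> hom (braid_group n) (GL TYPE('k) (m ^ n))"
    using rack_counting_matrix_in_GL[OF e] rack_counting_matrix_mult[OF e] \<open>card X = m\<close>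
    by (auto intro!: homI simp: GL_def units_of_def ring_mat_def)
  ultimately show ?thesis
    using rack_counting_matrix_mult[OF e] group_braid_group
    by (auto simp: linear_representation_def group_hom_def group_hom_axioms_def)
qed

end
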